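(* Let $P \in [0,1]^{n\times n}$ be an irreducible stochastic matrix with rational entries, and let $\pi \in (0,1]^n$ be its stationary distribution. Then $\pi$ is a vector of rational numbers whose lowest common denominator is not greater than $\min\{nD, nM^{n-1}\}$.
   Context: For each $i \in \{1,\dots,n\}$, $M_i$ denotes the lowest common denominator of the entries of the $i$-th row of $P$; $M$ denotes the lowest common denominator of all entries of $P$; and $D \coloneqq M_1 M_2 \cdots M_n$. *)

theory Defs
  imports Complex_Main "Jordan_Normal_Form.Matrix"
begin

(* Row-stochastic; together with non-negativity, the row sums force all entries into [0,1]. *)
definition stochastic_mat :: "nat \<Rightarrow> real mat \<Rightarrow> bool" where
  "stochastic_mat n P \<longleftrightarrow> P \<in> carrier_mat n n \<and>
     (\<forall>i<n. \<forall>j<n. 0 \<le> P $$ (i, j)) \<and>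
     (\<forall>i<n. (\<Sum>j<n. P $$ (i, j)) = 1)"

(* The exponent k = 0 only matters for i = j, where it changes nothing for stochastic matrices. *)
definition irreducible_mat :: "nat \<Rightarrow> real mat \<Rightarrow> bool" where
  "irreducible_mat n P \<longleftrightarrow> (\<forall>i<n. \<forall>j<n. \<exists>k. 0 < (P ^\<^sub>m k) $$ (i, j))"

(* The distribution is a row vector acting from the left, hence the transpose. *)
definition stationary_distribution :: "nat \<Rightarrow> real mat \<Rightarrow> real vec \<Rightarrow> bool" where
  "stationary_distribution n P \<pi> \<longleftrightarrow> \<pi> \<in> carrier_vec n \<and>
     (\<forall>i<n. 0 \<le> \<pi> $ i) \<and> (\<Sum>i<n. \<pi> $ i) = 1 \<and>
     transpose_mat P *\<^sub>v \<pi> = \<pi>"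

(* Only meaningful for finite sets of rational numbers, see lcd_props; otherwise there may be
   no common denominator and the value is unspecified. *)
definition lcd :: "real set \<Rightarrow> nat" where
  "lcd S = (LEAST d. 0 < d \<and> (\<forall>x\<in>S. real d * x \<in> \<int>))"

lemma lcd_exists:
  assumes "finite S" "S \<subseteq> \<rat>"
  shows "\<exists>d::nat. 0 < d \<and> (\<forall>x\<in>S. real d * x \<in> \<int>)"
  using assms
proof (induction S rule: finite_induct)
  case empty
  show ?case by (intro exI[of _ 1]) simp
next
  case (insert y S)
  then obtain d :: nat where d: "0 < d" "\<forall>x\<in>S. real d * x \<in> \<int>" by auto
  from insert.prems obtain a :: int and b :: int where b: "0 < b" "y = of_int a / of_int b"
    by (auto elim: Rats_cases')
  have "real (d * nat b) * y = of_int (int d * a)"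
    using b by simp
  then have "real (d * nat b) * y \<in> \<int>" by (metis Ints_of_int)
  moreover have "real (d * nat b) * x \<in> \<int>" if "x \<in> S" for x
  proof -
    have "real (d * nat b) * x = real (nat b) * (real d * x)" by simp
    then show ?thesis using d that by (metis Ints_mult Ints_of_nat)
  qed
  ultimately show ?case using d(1) b(1) by (intro exI[of _ "d * nat b"]) auto
qed

lemma lcd_props:
  assumes "finite S" "S \<subseteq> \<rat>"
  shows "0 < lcd S" "x \<in> S \<Longrightarrow> real (lcd S) * x \<in> \<int>"
  using LeastI_ex[OF lcd_exists[OF assms]] unfolding lcd_def by auto

definition row_lcd :: "real mat \<Rightarrow> nat \<Rightarrow> nat" where
  "row_lcd P i = lcd (set\<^sub>v (row P i))"

definition mat_lcd :: "real mat \<Rightarrow> nat" where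
  "mat_lcd P = lcd (elements_mat P)"

definition row_lcd_prod :: "nat \<Rightarrow> real mat \<Rightarrow> nat" where
  "row_lcd_prod n P = (\<Prod>i<n. row_lcd P i)"

end

theory Submission
  imports Defs "Jordan_Normal_Form.Determinant"
begin

text \<open>
  The diagonal cofactors c(i) of I - P form a left null vector of I - P: since P is irreducible,
  the right null space of I - P consists of the constant vectors, so the adjugate of I - P has
  constant columns, and each of its rows is a left null vector. The left null space is
  one-dimensional, and the sum of the c(i) is the nonzero determinant of I - P with one column
  replaced by ones; hence the stationary distribution is c normalised by its sum. Schur
  complementation preserves substochasticity, which yields 0 \<le> c(i) \<le> 1. Finally
  both D c(i) and M^(n-1) c(i) are integers, so D \<Sum>c and M^(n-1) \<Sum>c are common denominators.
\<close>

section \<open>Determinants of \<open>I - Q\<close> for substochastic \<open>Q\<close>, and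
  integrality of scaled determinants\<close>

text \<open>One step of block LU elimination: \<open>?L\<close> is unit lower triangular, and
  \<open>?U\<close> is block upper triangular with the pivot and the Schur complement on its
  diagonal.\<close>

lemma det_schur_complement:
  fixes A :: "'a :: field mat"
  assumes A: "A \<in> carrier_mat (Suc k) (Suc k)" and a: "A $$ (0, 0) \<noteq> 0"
  shows "det A = A $$ (0, 0) *
    det (mat k k (\<lambda>(i, j). A $$ (Suc i, Suc j) - A $$ (Suc i, 0) * A $$ (0, Suc j) / A $$ (0, 0)))"
proof -
  let ?a = "A $$ (0, 0)"
  let ?S = "mat k k (\<lambda>(i, j). A $$ (Suc i, Suc j) - A $$ (Suc i, 0) * A $$ (0, Suc j) / ?a)"
  let ?L3 = "mat k 1 (\<lambda>(i, _). A $$ (Suc i, 0) / ?a)"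
  let ?U1 = "mat 1 1 (\<lambda>_. ?a)"
  let ?U2 = "mat 1 k (\<lambda>(_, j). A $$ (0, Suc j))"
  let ?L = "four_block_mat (1\<^sub>m 1) (0\<^sub>m 1 k) ?L3 (1\<^sub>m k)"
  let ?U = "four_block_mat ?U1 ?U2 (0\<^sub>m k 1) ?S"
  have "?L * ?U = four_block_mat (1\<^sub>m 1 * ?U1 + 0\<^sub>m 1 k * 0\<^sub>m k 1) (1\<^sub>m 1 * ?U2 + 0\<^sub>m 1 k * ?S)
      (?L3 * ?U1 + 1\<^sub>m k * 0\<^sub>m k 1) (?L3 * ?U2 + 1\<^sub>m k * ?S)"
    by (rule mult_four_block_mat) auto
  also have "\<dots> = four_block_mat ?U1 ?U2 (?L3 * ?U1) (?L3 * ?U2 + ?S)"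
  proof -
    have "1\<^sub>m 1 * ?U1 + 0\<^sub>m 1 k * 0\<^sub>m k 1 = ?U1"
      "1\<^sub>m 1 * ?U2 + 0\<^sub>m 1 k * ?S = ?U2"
      "?L3 * ?U1 + 1\<^sub>m k * 0\<^sub>m k 1 = ?L3 * ?U1"
      "1\<^sub>m k * ?S = ?S"
      by (auto simp: left_mult_one_mat[of _ 1 k] left_mult_one_mat[of _ k k]
          left_mult_zero_mat[of _ k k] left_mult_one_mat[of _ 1 1])
    then show ?thesis by presburger
  qed
  also have "\<dots> = A"
  proof (rule eq_matI)
    fix i j assume "i < dim_row A" "j < dim_col A"
    then show "four_block_mat ?U1 ?U2 (?L3 * ?U1) (?L3 * ?U2 + ?S) $$ (i, j) = A $$ (i, j)"
      using A a by (cases i; cases j) (auto simp: scalar_prod_def)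
  qed (use A in auto)
  finally have LU: "A = ?L * ?U" ..
  have "?L \<in> carrier_mat (1 + k) (1 + k)" "?U \<in> carrier_mat (1 + k) (1 + k)" by auto
  then have "det (?L * ?U) = det ?L * det ?U" by (rule det_mult)
  with arg_cong[OF LU, of det] have "det A = det ?L * det ?U" by (rule trans)
  also have "det ?L = 1"
    by (subst det_four_block_mat_upper_right_zero[of _ 1 _ k]) auto
  also have "det ?U = ?a * det ?S"
    by (subst det_four_block_mat_lower_left_zero[of _ 1 _ k]) (auto simp: det_single)
  finally show ?thesis by simp
qed

text \<open>Induction by eliminating state 0. If its pivot vanishes, so does the whole row 0;
  otherwise the Schur complement is again the identity minus a substochastic matrix, and the
  determinant is a product of two numbers in [0,1].\<close>

lemma det_one_minus_substochastic:
  fixes q :: "nat \<Rightarrow> nat \<Rightarrow> real"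
  assumes "\<And>i j. i < k \<Longrightarrow> j < k \<Longrightarrow> 0 \<le> q i j"
    and "\<And>i. i < k \<Longrightarrow> (\<Sum>j<k. q i j) \<le> 1"
  shows "det (mat k k (\<lambda>(i, j). (if i = j then 1 else 0) - q i j)) \<in> {0..1}"
  using assms
proof (induction k arbitrary: q)
  case 0
  then show ?case by simp
next
  case (Suc k)
  let ?A = "mat (Suc k) (Suc k) (\<lambda>(i, j). (if i = j then 1 else 0) - q i j)"
  have A: "?A \<in> carrier_mat (Suc k) (Suc k)" by simp
  have q: "0 \<le> q i j" if "i < Suc k" "j < Suc k" for i j
    using Suc.prems(1) that .
  have row: "q i 0 + (\<Sum>j<k. q i (Suc j)) \<le> 1" if "i < Suc k" for i
    using Suc.prems(2)[OF that] by (simp only: sum.lessThan_Suc_shift)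
  have tail: "0 \<le> (\<Sum>j<k. q i (Suc j))" if "i < Suc k" for i
    using q that by (intro sum_nonneg) auto
  show ?case
  proof (cases "q 0 0 = 1")
    case True
    with row[of 0] tail[of 0] have "(\<Sum>j<k. q 0 (Suc j)) = 0" by simp
    then have "q 0 (Suc j) = 0" if "j < k" for j
      using that q by (subst (asm) sum_nonneg_eq_0_iff) auto
    with True have "?A $$ (0, j) = 0" if "j < Suc k" for j
      using that by (cases j) auto
    then have "det ?A = 0"
      by (subst laplace_expansion_row[OF A, of 0]) (auto intro!: sum.neutral)
    then show ?thesis by simp
  next
    case False
    define a where "a = 1 - q 0 0"
    have a: "0 < a" "a \<le> 1"
      using False row[of 0] tail[of 0] q[of 0 0] by (auto simp: a_def)
    \<comment> \<open>\<open>q'\<close> belongs to the chain watched outside state 0: a direct move,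
      or a detour through 0, where \<open>1 / a\<close> sums the geometric series of repeated stays
      at 0.\<close>
    define q' where "q' i j = q (Suc i) (Suc j) + q (Suc i) 0 * q 0 (Suc j) / a" for i j
    have "det (mat k k (\<lambda>(i, j). (if i = j then 1 else 0) - q' i j)) \<in> {0..1}"
    proof (rule Suc.IH)
      show "0 \<le> q' i j" if "i < k" "j < k" for i j
        using that a q by (auto simp: q'_def)
      show "(\<Sum>j<k. q' i j) \<le> 1" if "i < k" for i
      proof -
        have "(\<Sum>j<k. q' i j) =
            (\<Sum>j<k. q (Suc i) (Suc j)) + q (Suc i) 0 * ((\<Sum>j<k. q 0 (Suc j)) / a)"
          by (simp add: q'_def sum.distrib sum_distrib_left sum_divide_distrib)
        \<comment> \<open>Row 0 carries mass at most \<open>a\<close> outside state 0, so the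
          quotient by \<open>a\<close> is at most 1.\<close>
        also have "\<dots> \<le> (\<Sum>j<k. q (Suc i) (Suc j)) + q (Suc i) 0 * 1"
          using that q row[of 0] a by (intro add_mono mult_left_mono) (auto simp: a_def)
        also have "\<dots> \<le> 1" using row[of "Suc i"] that by simp
        finally show ?thesis .
      qed
    qed
    moreover have "det ?A = a * det (mat k k (\<lambda>(i, j). (if i = j then 1 else 0) - q' i j))"
    proof -
      have "mat k k (\<lambda>(i, j). ?A $$ (Suc i, Suc j) - ?A $$ (Suc i, 0) * ?A $$ (0, Suc j) / ?A $$ (0, 0))
          = mat k k (\<lambda>(i, j). (if i = j then 1 else 0) - q' i j)"
        by (rule eq_matI) (auto simp: q'_def a_def)
      then show ?thesis using det_schur_complement[OF A] a by (simp add: a_def)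
    qed
    ultimately show ?thesis using a by (auto intro: mult_le_one)
  qed
qed

text \<open>Each Leibniz term takes exactly one entry from every row, so the factors
  \<open>d i\<close> distribute over it and make it an integer.\<close>

lemma det_scaled_rows_Ints:
  fixes A :: "'a :: comm_ring_1 mat"
  assumes A: "A \<in> carrier_mat k k"
    and d: "\<And>i j. i < k \<Longrightarrow> j < k \<Longrightarrow> d i * A $$ (i, j) \<in> \<int>"
  shows "(\<Prod>i<k. d i) * det A \<in> \<int>"
proof -
  have "(\<Prod>i<k. d i) * det A =
      (\<Sum>p | p permutes {0..<k}. signof p * (\<Prod>i = 0..<k. d i * A $$ (i, p i)))"
    by (simp add: det_def'[OF A] sum_distrib_left prod.distrib atLeast0LessThan mult_ac)
  also have "\<dots> \<in> \<int>"
  proof (intro Ints_sum Ints_mult[OF _ Ints_prod])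
    fix p i assume "p \<in> {p. p permutes {0..<k}}" "i \<in> {0..<k}"
    then show "d i * A $$ (i, p i) \<in> \<int>"
      using d permutes_in_image[of p "{0..<k}" i] by simp
  qed (auto simp: sign_def)
  finally show ?thesis .
qed

section \<open>Irreducibility: closed sets, harmonic functions and invariant vectors\<close>

text \<open>A positive entry of a power of \<open>P\<close> yields a path of positive entries of
  \<open>P\<close>, and such a path cannot leave \<open>S\<close>.\<close>

lemma irreducible_mat_closed_set:
  assumes st: "stochastic_mat n P" and irr: "irreducible_mat n P"
    and closed: "\<And>i j. i < n \<Longrightarrow> j < n \<Longrightarrow> i \<in> S \<Longrightarrow> 0 < P $$ (i, j) \<Longrightarrow> j \<in> S"
    and "i < n" "i \<in> S" "j < n"
  shows "j \<in> S"
proof -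
  have P: "P \<in> carrier_mat n n" and nonneg: "\<And>i j. i < n \<Longrightarrow> j < n \<Longrightarrow> 0 \<le> P $$ (i, j)"
    using st by (auto simp: stochastic_mat_def)
  have reach: "j \<in> S" if "0 < (P ^\<^sub>m k) $$ (i, j)" "j < n" for k j
    using that
  proof (induction k arbitrary: j)
    case 0
    then show ?case using P \<open>i < n\<close> \<open>i \<in> S\<close> by (auto split: if_splits)
  next
    case (Suc k)
    have "(P ^\<^sub>m Suc k) $$ (i, j) = (\<Sum>l<n. (P ^\<^sub>m k) $$ (i, l) * P $$ (l, j))"
      using P \<open>i < n\<close> Suc.prems by (simp add: scalar_prod_def atLeast0LessThan)
    with Suc.prems have "\<not> (\<Sum>l<n. (P ^\<^sub>m k) $$ (i, l) * P $$ (l, j)) \<le> 0" by simp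
    then have "\<not> (\<forall>l<n. (P ^\<^sub>m k) $$ (i, l) * P $$ (l, j) \<le> 0)"
      by (meson lessThan_iff sum_nonpos)
    then obtain l where l: "l < n" "0 < (P ^\<^sub>m k) $$ (i, l) * P $$ (l, j)"
      by (auto simp: not_le)
    \<comment> \<open>A positive product could also come from two negative factors; nonnegativity of
      \<open>P\<close> excludes this.\<close>
    then have "0 < (P ^\<^sub>m k) $$ (i, l)" "0 < P $$ (l, j)"
      using nonneg[of l j] Suc.prems by (auto simp: zero_less_mult_iff)
    then show ?case using Suc.IH closed l(1) Suc.prems by blast
  qed
  then show ?thesis using irr assms(4,6) unfolding irreducible_mat_def by blast
qed

text \<open>Maximum principle: where \<open>x\<close> is maximal, its average over the successors is
  maximal too, so every successor is a maximiser. The maximisers thus form a nonempty closed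
  set.\<close>

lemma harmonic_constant:
  assumes st: "stochastic_mat n P" and irr: "irreducible_mat n P"
    and harm: "\<And>i. i < n \<Longrightarrow> (\<Sum>j<n. P $$ (i, j) * x j) = x i"
    and "i < n" "j < n"
  shows "x i = x j"
proof -
  define m where "m = Max (x ` {..<n})"
  have le: "x i \<le> m" if "i < n" for i using that by (auto simp: m_def)
  have "m \<in> x ` {..<n}" unfolding m_def using \<open>i < n\<close> by (intro Max_in) auto
  then obtain i0 where i0: "i0 < n" "x i0 = m" by auto
  have "j \<in> {j. x j = m}" if "j < n" for j
  proof (rule irreducible_mat_closed_set[OF st irr _ i0(1) _ that])
    fix i j assume ij: "i < n" "j < n" "i \<in> {j. x j = m}" "0 < P $$ (i, j)"
    have nonneg: "\<And>l. l < n \<Longrightarrow> 0 \<le> P $$ (i, l)" and sum: "(\<Sum>j<n. P $$ (i, j)) = 1"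
      using st ij(1) by (auto simp: stochastic_mat_def)
    have "(\<Sum>j<n. P $$ (i, j) * (m - x j)) = 0"
      using harm[OF ij(1)] ij(3) sum
      by (simp add: right_diff_distrib sum_subtractf flip: sum_distrib_right)
    then have "P $$ (i, j) * (m - x j) = 0"
      using nonneg le ij(2) by (subst (asm) sum_nonneg_eq_0_iff) auto
    then show "j \<in> {j. x j = m}" using ij(4) by simp
  qed (use i0 in simp)
  then show ?thesis using assms(4,5) by auto
qed

text \<open>Subtracting a suitable multiple of \<open>p\<close> from \<open>v\<close> leaves a
  nonnegative invariant vector with a zero entry. The support of such a vector is closed, hence
  empty.\<close>

lemma stationary_vector_unique:
  assumes st: "stochastic_mat n P" and irr: "irreducible_mat n P"
    and p: "\<And>j. j < n \<Longrightarrow> (\<Sum>i<n. p i * P $$ (i, j)) = p j" "\<And>j. j < n \<Longrightarrow> 0 < p j"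
    and v: "\<And>j. j < n \<Longrightarrow> (\<Sum>i<n. v i * P $$ (i, j)) = v j"
  obtains t :: real where "\<And>j. j < n \<Longrightarrow> v j = t * p j"
proof (cases "n = 0")
  case True
  then show ?thesis using that by simp
next
  case False
  \<comment> \<open>The largest \<open>t\<close> for which \<open>v - t * p\<close> is nonnegative;
    an index attaining the minimum gives the zero entry.\<close>
  define t where "t = Min ((\<lambda>i. v i / p i) ` {..<n})"
  define u where "u i = v i - t * p i" for i
  have u_nonneg: "0 \<le> u i" if "i < n" for i
  proof -
    have "t \<le> v i / p i" using that by (auto simp: t_def)
    then show ?thesis using p(2)[OF that] by (simp add: u_def field_simps)
  qed
  have "t \<in> (\<lambda>i. v i / p i) ` {..<n}"
    unfolding t_def using False by (intro Min_in) auto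
  then obtain i0 where i0: "i0 < n" "t = v i0 / p i0" by auto
  then have u0: "u i0 = 0" using p(2)[of i0] by (simp add: u_def)
  have u_inv: "(\<Sum>i<n. u i * P $$ (i, j)) = u j" if "j < n" for j
    using p(1)[OF that] v[OF that]
    by (simp add: u_def left_diff_distrib sum_subtractf mult.assoc flip: sum_distrib_left)
  have "u j = 0" if "j < n" for j
  proof (rule ccontr)
    assume "u j \<noteq> 0"
    have "i0 \<in> {i. 0 < u i}"
    proof (rule irreducible_mat_closed_set[OF st irr _ that _ i0(1)])
      fix i j assume ij: "i < n" "j < n" "i \<in> {i. 0 < u i}" "0 < P $$ (i, j)"
      have "0 < u i * P $$ (i, j)" using ij by simp
      also have "\<dots> \<le> (\<Sum>i<n. u i * P $$ (i, j))"
        using st ij u_nonneg by (intro member_le_sum) (auto simp: stochastic_mat_def)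
      finally show "j \<in> {i. 0 < u i}" using u_inv[OF ij(2)] by simp
    qed (use \<open>u j \<noteq> 0\<close> u_nonneg[OF that] in simp)
    then show False using u0 by simp
  qed
  then show ?thesis using that[of t] by (simp add: u_def)
qed

section \<open>Common denominators of a normalised vector\<close>

lemma lcd_le:
  assumes "0 < d" "\<And>x. x \<in> S \<Longrightarrow> real d * x \<in> \<int>"
  shows "lcd S \<le> d"
  unfolding lcd_def by (rule Least_le) (use assms in auto)

text \<open>With \<open>s\<close> the sum of the \<open>c i\<close>, the integer
  \<open>d * s\<close> is a common denominator, since it turns \<open>c i / s\<close> into
  \<open>d * c i\<close>. It is at most \<open>n * d\<close> because each \<open>c i\<close> is at
  most 1.\<close>

lemma lcd_normalised_le:
  assumes d: "0 < d" and c: "\<And>i. i < n \<Longrightarrow> real d * c i \<in> \<int>" "\<And>i. i < n \<Longrightarrow> c i \<le> 1"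
    and s: "0 < (\<Sum>i<n. c i)"
  shows "(\<lambda>i. c i / (\<Sum>i<n. c i)) ` {..<n} \<subseteq> \<rat>"
    and "lcd ((\<lambda>i. c i / (\<Sum>i<n. c i)) ` {..<n}) \<le> n * d"
proof -
  let ?s = "\<Sum>i<n. c i"
  have ds: "real d * ?s \<in> \<int>"
    unfolding sum_distrib_left using c(1) by (intro Ints_sum) auto
  then obtain N where N: "real d * ?s = of_int N" by (auto elim: Ints_cases)
  have pos: "0 < real d * ?s" using d s by simp
  show "(\<lambda>i. c i / ?s) ` {..<n} \<subseteq> \<rat>"
  proof (clarsimp)
    fix i assume "i < n"
    have "c i / ?s = (real d * c i) / (real d * ?s)" using d by simp
    also have "\<dots> \<in> \<rat>"
      using c(1)[OF \<open>i < n\<close>] ds Ints_subset_Rats by (intro Rats_divide) auto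
    finally show "c i / ?s \<in> \<rat>" .
  qed
  have "lcd ((\<lambda>i. c i / ?s) ` {..<n}) \<le> nat N"
  proof (rule lcd_le)
    show "0 < nat N" using pos N by simp
    fix x assume "x \<in> (\<lambda>i. c i / ?s) ` {..<n}"
    then obtain i where i: "i < n" "x = c i / ?s" by auto
    have "real (nat N) * x = real d * ?s * x" using pos N by simp
    also have "\<dots> = real d * c i" using s i(2) by simp
    finally show "real (nat N) * x \<in> \<int>" using c(1)[OF i(1)] by simp
  qed
  also have "nat N \<le> n * d"
  proof -
    have "?s \<le> real n" using sum_bounded_above[of "{..<n}" c 1] c(2) by simp
    then have "real d * ?s \<le> real d * real n" by (intro mult_left_mono) auto
    then have "real_of_int N \<le> real_of_int (int (n * d))" unfolding N by (simp add: mult.commute)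
    then show ?thesis by linarith
  qed
  finally show "lcd ((\<lambda>i. c i / ?s) ` {..<n}) \<le> n * d" .
qed

section \<open>Principal cofactors of \<open>I - P\<close>: bounds and integrality\<close>

lemma cofactor_replace_col:
  assumes "A \<in> carrier_mat n n" "B \<in> carrier_mat n n" "i < n" "j < n"
    and "\<And>i l. i < n \<Longrightarrow> l < n \<Longrightarrow> l \<noteq> j \<Longrightarrow> A $$ (i, l) = B $$ (i, l)"
  shows "cofactor A i j = cofactor B i j"
proof -
  have "mat_delete A i j = mat_delete B i j"
    using assms by (intro eq_matI) (auto simp: mat_delete_def)
  then show ?thesis by (simp add: cofactor_def)
qed

text \<open>\<open>insert_index i\<close> enumerates the indices other than \<open>i\<close>; this
  and the product version translate between a minor and the full matrix.\<close>

lemma sum_insert_index: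
  fixes f :: "nat \<Rightarrow> 'a :: comm_monoid_add"
  assumes "i < n"
  shows "(\<Sum>j<n - 1. f (insert_index i j)) = sum f ({..<n} - {i})"
  using sum.reindex[OF insert_index_inj_on, of f i "{0..<n - 1}"] insert_index_image[of i "n - 1"] assms
  by (simp add: atLeast0LessThan)

lemma prod_insert_index:
  fixes f :: "nat \<Rightarrow> 'a :: comm_monoid_mult"
  assumes "i < n"
  shows "(\<Prod>j<n - 1. f (insert_index i j)) = prod f ({..<n} - {i})"
  using prod.reindex[OF insert_index_inj_on, of f i "{0..<n - 1}"] insert_index_image[of i "n - 1"] assms
  by (simp add: atLeast0LessThan)

lemma insert_index_less: "i < n \<Longrightarrow> j < n - 1 \<Longrightarrow> insert_index i j < n"
  by (auto simp: insert_index_def)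

lemma cofactor_diag: "cofactor A i i = det (mat_delete A i i)"
  by (simp add: cofactor_def)

text \<open>Deleting row and column \<open>i\<close> leaves the identity minus the restriction of
  \<open>P\<close> to the other states, which is substochastic because dropping a column can only
  lower the row sums.\<close>

lemma cofactor_one_minus_bounds:
  assumes st: "stochastic_mat n P" and "i < n"
  shows "cofactor (1\<^sub>m n - P) i i \<in> {0..1}"
proof -
  have P: "P \<in> carrier_mat n n" using st by (simp add: stochastic_mat_def)
  let ?q = "\<lambda>k l. P $$ (insert_index i k, insert_index i l)"
  have "mat_delete (1\<^sub>m n - P) i i =
      mat (n - 1) (n - 1) (\<lambda>(k, l). (if k = l then 1 else 0) - ?q k l)"
    using P \<open>i < n\<close> by (intro eq_matI) (auto simp: mat_delete_def insert_index_def)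
  moreover have "det (mat (n - 1) (n - 1) (\<lambda>(k, l). (if k = l then 1 else 0) - ?q k l)) \<in> {0..1}"
  proof (rule det_one_minus_substochastic)
    show "0 \<le> ?q k l" if "k < n - 1" "l < n - 1" for k l
      using st that \<open>i < n\<close> by (simp add: stochastic_mat_def insert_index_less)
    show "(\<Sum>l<n - 1. ?q k l) \<le> 1" if "k < n - 1" for k
    proof -
      let ?k = "insert_index i k"
      have k: "?k < n" using that \<open>i < n\<close> by (rule insert_index_less[rotated])
      have "(\<Sum>l<n - 1. ?q k l) = (\<Sum>l\<in>{..<n} - {i}. P $$ (?k, l))"
        by (rule sum_insert_index[OF \<open>i < n\<close>])
      also have "\<dots> \<le> (\<Sum>l<n. P $$ (?k, l))"
        using st k by (intro sum_mono2) (auto simp: stochastic_mat_def)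
      also have "\<dots> = 1" using st k by (simp add: stochastic_mat_def)
      finally show ?thesis .
    qed
  qed
  ultimately show ?thesis by (simp add: cofactor_diag)
qed

text \<open>The minor has no row \<open>i\<close>, so the factors of the other rows suffice. For
  constant \<open>d\<close> this is the source of the exponent \<open>n - 1\<close>.\<close>

lemma cofactor_one_minus_Ints:
  fixes P :: "'a :: comm_ring_1 mat"
  assumes P: "P \<in> carrier_mat n n" and "i < n"
    and d: "\<And>k l. k < n \<Longrightarrow> l < n \<Longrightarrow> d k * P $$ (k, l) \<in> \<int>" "\<And>k. k < n \<Longrightarrow> d k \<in> \<int>"
  shows "prod d ({..<n} - {i}) * cofactor (1\<^sub>m n - P) i i \<in> \<int>"
proof -
  have "(\<Prod>k<n - 1. d (insert_index i k)) * det (mat_delete (1\<^sub>m n - P) i i) \<in> \<int>"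
  proof (rule det_scaled_rows_Ints)
    show "mat_delete (1\<^sub>m n - P) i i \<in> carrier_mat (n - 1) (n - 1)"
      using P by (intro mat_delete_carrier) auto
    fix k l assume kl: "k < n - 1" "l < n - 1"
    let ?k = "insert_index i k" and ?l = "insert_index i l"
    have kl': "?k < n" "?l < n" using kl \<open>i < n\<close> by (auto intro: insert_index_less)
    have "mat_delete (1\<^sub>m n - P) i i $$ (k, l) = (if ?k = ?l then 1 else 0) - P $$ (?k, ?l)"
      using P kl kl' by (auto simp: mat_delete_def insert_index_def)
    \<comment> \<open>On the diagonal, the entry 1 of the identity contributes \<open>d ?k\<close>
      itself, which is an integer.\<close>
    then show "d ?k * mat_delete (1\<^sub>m n - P) i i $$ (k, l) \<in> \<int>"
      using d kl' by (auto simp: right_diff_distrib)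
  qed
  then show ?thesis unfolding prod_insert_index[OF \<open>i < n\<close>] cofactor_diag .
qed

section \<open>The stationary distribution as normalised cofactors\<close>

lemma stationary_distribution_cofactor:
  assumes st: "stochastic_mat n P" and irr: "irreducible_mat n P"
    and sd: "stationary_distribution n P \<pi>" and pos: "\<And>i. i < n \<Longrightarrow> 0 < \<pi> $ i"
  shows "0 < (\<Sum>i<n. cofactor (1\<^sub>m n - P) i i)"
    and "i < n \<Longrightarrow> \<pi> $ i = cofactor (1\<^sub>m n - P) i i / (\<Sum>i<n. cofactor (1\<^sub>m n - P) i i)"
proof -
  define A where "A = 1\<^sub>m n - P"
  define c where "c i = cofactor A i i" for i
  have P: "P \<in> carrier_mat n n" and rows: "\<And>i. i < n \<Longrightarrow> (\<Sum>j<n. P $$ (i, j)) = 1"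
    using st by (auto simp: stochastic_mat_def)
  have A: "A \<in> carrier_mat n n" using P by (auto simp: A_def)
  have A_entry: "A $$ (i, j) = (if i = j then 1 else 0) - P $$ (i, j)" if "i < n" "j < n" for i j
    using P that by (auto simp: A_def)
  have left: "(\<Sum>i<n. v i * A $$ (i, j)) = v j - (\<Sum>i<n. v i * P $$ (i, j))" if "j < n" for v j
  proof -
    have "(\<Sum>i<n. v i * A $$ (i, j)) = (\<Sum>i<n. (if i = j then v i else 0) - v i * P $$ (i, j))"
      using that by (intro sum.cong) (auto simp: A_entry algebra_simps)
    then show ?thesis using that by (simp add: sum_subtractf)
  qed
  have right: "(\<Sum>j<n. A $$ (i, j) * x j) = x i - (\<Sum>j<n. P $$ (i, j) * x j)" if "i < n" for x i
  proof -
    have "(\<Sum>j<n. A $$ (i, j) * x j) = (\<Sum>j<n. (if i = j then x j else 0) - P $$ (i, j) * x j)"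
      using that by (intro sum.cong) (auto simp: A_entry algebra_simps)
    then show ?thesis using that by (simp add: sum_subtractf)
  qed
  have pi_dim: "\<pi> \<in> carrier_vec n" and pi_sum: "(\<Sum>i<n. \<pi> $ i) = 1"
    using sd by (auto simp: stationary_distribution_def)
  have pi_inv: "(\<Sum>i<n. \<pi> $ i * P $$ (i, j)) = \<pi> $ j" if "j < n" for j
  proof -
    have "(transpose_mat P *\<^sub>v \<pi>) $ j = (\<Sum>i<n. \<pi> $ i * P $$ (i, j))"
      using P pi_dim that by (simp add: scalar_prod_def atLeast0LessThan mult.commute)
    then show ?thesis using sd by (simp add: stationary_distribution_def)
  qed
  have n: "0 < n" using pi_sum by (cases n) auto
  have sum_A: "(\<Sum>j<n. A $$ (i, j)) = 0" if "i < n" for i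
    using right[OF that, of "\<lambda>_. 1"] rows[OF that] by simp
  \<comment> \<open>Once \<open>A\<close> is singular, its products with the adjugate on either side
    are zero.\<close>
  have det0: "det A = 0"
  proof -
    have "A *\<^sub>v vec n (\<lambda>_. 1) = 0\<^sub>v n"
      using A sum_A by (intro eq_vecI) (auto simp: scalar_prod_def atLeast0LessThan)
    moreover have "vec n (\<lambda>_. 1) \<noteq> (0\<^sub>v n :: real vec)"
      using n by (metis index_vec index_zero_vec(1) zero_neq_one)
    ultimately show ?thesis
      using det_0_iff_vec_prod_zero[OF A] by (metis vec_carrier)
  qed
  have adj: "adj_mat A $$ (i, j) = cofactor A j i" if "i < n" "j < n" for i j
    using A that by (simp add: adj_mat_def)
  have adj_dim: "adj_mat A \<in> carrier_mat n n" using adj_mat(1)[OF A] .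
  \<comment> \<open>Column \<open>j\<close> of the adjugate is annihilated by \<open>A\<close>,
    hence harmonic for \<open>P\<close>, hence constantly equal to its diagonal entry.\<close>
  have adj_const: "cofactor A j i = c j" if "i < n" "j < n" for i j
  proof -
    have "(\<Sum>l<n. P $$ (k, l) * cofactor A j l) = cofactor A j k" if "k < n" for k
    proof -
      have "(A * adj_mat A) $$ (k, j) = 0"
        using adj_mat(2)[OF A] det0 that \<open>j < n\<close> by simp
      then have "(\<Sum>l<n. A $$ (k, l) * cofactor A j l) = 0"
        using A adj_dim that \<open>j < n\<close> adj by (simp add: scalar_prod_def atLeast0LessThan)
      then show ?thesis using right[OF that] by simp
    qed
    then show ?thesis unfolding c_def
      by (rule harmonic_constant[OF st irr]) (use that in auto)
  qed
  \<comment> \<open>As the columns are constant, row 0 of the adjugate is \<open>c\<close>, so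
    \<open>c\<close> is a left null vector of \<open>A\<close>.\<close>
  have c_inv: "(\<Sum>i<n. c i * P $$ (i, j)) = c j" if "j < n" for j
  proof -
    have "(adj_mat A * A) $$ (0, j) = 0"
      using adj_mat(3)[OF A] det0 that n by simp
    then have "(\<Sum>i<n. c i * A $$ (i, j)) = 0"
      using A adj_dim that n adj adj_const by (simp add: scalar_prod_def atLeast0LessThan)
    then show ?thesis using left[OF that] by simp
  qed
  obtain t where t: "\<And>j. j < n \<Longrightarrow> c j = t * \<pi> $ j"
    using stationary_vector_unique[OF st irr pi_inv pos c_inv] by blast
  have "(\<Sum>i<n. c i) = t * (\<Sum>i<n. \<pi> $ i)" using t by (simp add: sum_distrib_left)
  then have sum_c: "(\<Sum>i<n. c i) = t" using pi_sum by simp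
  have "t \<noteq> 0"
  proof
    assume "t = 0"
    \<comment> \<open>Replacing column 0 leaves the cofactors along it unchanged, so expanding there
      gives the sum of the \<open>c i\<close> as \<open>det B\<close>; \<open>t = 0\<close> would
      make \<open>B\<close> singular.\<close>
    define B where "B = mat n n (\<lambda>(i, j). if j = 0 then 1 else A $$ (i, j))"
    have B: "B \<in> carrier_mat n n" by (simp add: B_def)
    have "det B = (\<Sum>i<n. B $$ (i, 0) * cofactor B i 0)"
      by (rule laplace_expansion_column[OF B n])
    also have "\<dots> = (\<Sum>i<n. c i)"
    proof (rule sum.cong)
      fix i assume "i \<in> {..<n}"
      moreover have "cofactor B i 0 = cofactor A i 0"
        using calculation n by (intro cofactor_replace_col[OF B A]) (auto simp: B_def)
      ultimately show "B $$ (i, 0) * cofactor B i 0 = c i"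
        using n adj_const[of 0 i] by (simp add: B_def)
    qed simp
    finally have "det (transpose_mat B) = 0"
      using sum_c \<open>t = 0\<close> det_transpose[OF B] by simp
    \<comment> \<open>A left null vector of \<open>B\<close> has entry sum zero, by column 0, and is
      orthogonal to every other column of \<open>A\<close>.\<close>
    then obtain v where v: "v \<in> carrier_vec n" "v \<noteq> 0\<^sub>v n" "transpose_mat B *\<^sub>v v = 0\<^sub>v n"
      using det_0_iff_vec_prod_zero[of "transpose_mat B" n] B by auto
    have vB: "(\<Sum>i<n. v $ i * B $$ (i, j)) = 0" if "j < n" for j
    proof -
      have "(transpose_mat B *\<^sub>v v) $ j = (\<Sum>i<n. v $ i * B $$ (i, j))"
        using B v(1) that by (simp add: scalar_prod_def atLeast0LessThan mult.commute)
      then show ?thesis using v(3) that by simp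
    qed
    have v_sum: "(\<Sum>i<n. v $ i) = 0" using vB[OF n] n by (simp add: B_def)
    have vA: "(\<Sum>i<n. v $ i * A $$ (i, j)) = 0" if "j < n" "j \<noteq> 0" for j
      using vB[OF that(1)] that by (simp add: B_def)
    \<comment> \<open>The column vectors of A add up to zero, so the remaining equation follows from the others.\<close>
    have vA0: "(\<Sum>i<n. v $ i * A $$ (i, 0)) = 0"
    proof -
      have "(\<Sum>j<n. \<Sum>i<n. v $ i * A $$ (i, j)) = (\<Sum>i<n. v $ i * (\<Sum>j<n. A $$ (i, j)))"
        unfolding sum_distrib_left by (rule sum.swap)
      also have "\<dots> = 0" using sum_A by simp
      finally have "(\<Sum>j<n. \<Sum>i<n. v $ i * A $$ (i, j)) = 0" .
      moreover have "(\<Sum>j<n. \<Sum>i<n. v $ i * A $$ (i, j)) = (\<Sum>i<n. v $ i * A $$ (i, 0))"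
        using vA n by (subst sum.remove[of _ 0]) (auto intro!: sum.neutral)
      ultimately show ?thesis by simp
    qed
    have v_inv: "(\<Sum>i<n. v $ i * P $$ (i, j)) = v $ j" if "j < n" for j
      using left[OF that, of "\<lambda>i. v $ i"] vA[OF that] vA0 by (cases "j = 0") auto
    obtain s where s: "\<And>j. j < n \<Longrightarrow> v $ j = s * \<pi> $ j"
      using stationary_vector_unique[OF st irr pi_inv pos v_inv] by blast
    \<comment> \<open>\<open>v\<close> is a multiple of \<open>\<pi>\<close>; comparing entry sums,
      0 against 1, forces the multiple to be zero.\<close>
    have "(\<Sum>i<n. v $ i) = s * (\<Sum>i<n. \<pi> $ i)" using s by (simp add: sum_distrib_left)
    then have "s = 0" using pi_sum v_sum by simp
    then have "v = 0\<^sub>v n" using s v(1) by (intro eq_vecI) auto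
    then show False using v(2) by simp
  qed
  moreover have "0 \<le> (\<Sum>i<n. c i)"
    using cofactor_one_minus_bounds[OF st] by (intro sum_nonneg) (auto simp: c_def A_def)
  ultimately have t_pos: "0 < t" using sum_c by simp
  then show "0 < (\<Sum>i<n. cofactor (1\<^sub>m n - P) i i)"
    using sum_c by (simp add: c_def A_def)
  show "\<pi> $ i = cofactor (1\<^sub>m n - P) i i / (\<Sum>i<n. cofactor (1\<^sub>m n - P) i i)" if "i < n"
    using t[OF that] sum_c t_pos by (simp add: c_def A_def)
qed

section \<open>The two denominator bounds for the stationary distribution\<close>

theorem theorem1p1:
  fixes n :: nat and P :: "real mat" and \<pi> :: "real vec"
  assumes "stochastic_mat n P"
    and "irreducible_mat n P"
    and "elements_mat P \<subseteq> \<rat>"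
    and "stationary_distribution n P \<pi>"
    and "set\<^sub>v \<pi> \<subseteq> {0<..1}"
  shows "set\<^sub>v \<pi> \<subseteq> \<rat> \<and>
         lcd (set\<^sub>v \<pi>) \<le> min (n * row_lcd_prod n P) (n * mat_lcd P ^ (n - 1))"
proof -
  define c where "c i = cofactor (1\<^sub>m n - P) i i" for i
  have P: "P \<in> carrier_mat n n" using assms(1) by (simp add: stochastic_mat_def)
  have pi_dim: "\<pi> \<in> carrier_vec n" using assms(4) by (simp add: stationary_distribution_def)
  have pos: "0 < \<pi> $ i" if "i < n" for i
    using assms(5) pi_dim that vec_setI[of \<pi> i] by auto
  note cof = stationary_distribution_cofactor[OF assms(1,2,4) pos, folded c_def]
  have set_pi: "set\<^sub>v \<pi> = (\<lambda>i. c i / (\<Sum>i<n. c i)) ` {..<n}"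
    using pi_dim cof(2) by (auto simp: vec_set_def)
  have c_le: "c i \<le> 1" if "i < n" for i
    using cofactor_one_minus_bounds[OF assms(1) that] by (simp add: c_def)
  have row_sub: "set\<^sub>v (row P i) \<subseteq> elements_mat P" if "i < n" for i
    using P that by (auto simp: vec_set_def)
  have fin: "finite (elements_mat P)" by (simp add: elements_mat_def)
  have row: "0 < row_lcd P i" "j < n \<Longrightarrow> real (row_lcd P i) * P $$ (i, j) \<in> \<int>" if "i < n" for i j
  proof -
    have S: "finite (set\<^sub>v (row P i))" "set\<^sub>v (row P i) \<subseteq> \<rat>"
      using row_sub[OF that] assms(3) fin finite_subset by blast+
    show "0 < row_lcd P i" using lcd_props(1)[OF S] by (simp add: row_lcd_def)
    assume "j < n"
    then have "P $$ (i, j) \<in> set\<^sub>v (row P i)"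
      using P that by (intro vec_setI[of _ j]) auto
    then show "real (row_lcd P i) * P $$ (i, j) \<in> \<int>"
      using lcd_props(2)[OF S] by (simp add: row_lcd_def)
  qed
  have all: "0 < mat_lcd P" "\<And>i j. i < n \<Longrightarrow> j < n \<Longrightarrow> real (mat_lcd P) * P $$ (i, j) \<in> \<int>"
    using lcd_props[OF fin assms(3)] P by (auto simp: mat_lcd_def)
  \<comment> \<open>The product over the rows other than \<open>i\<close> already clears
    \<open>c i\<close>; the remaining factor is an integer.\<close>
  have D: "real (row_lcd_prod n P) * c i \<in> \<int>" if "i < n" for i
  proof -
    let ?d = "\<lambda>k. real (row_lcd P k)"
    have "real (row_lcd_prod n P) = ?d i * prod ?d ({..<n} - {i})"
      using that by (simp add: row_lcd_prod_def prod.remove)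
    moreover have "prod ?d ({..<n} - {i}) * c i \<in> \<int>"
      unfolding c_def using row by (intro cofactor_one_minus_Ints[OF P that]) auto
    ultimately show ?thesis by (metis Ints_mult Ints_of_nat mult.assoc)
  qed
  have M: "real (mat_lcd P ^ (n - 1)) * c i \<in> \<int>" if "i < n" for i
    using cofactor_one_minus_Ints[OF P that, of "\<lambda>_. real (mat_lcd P)"] all that
    by (simp add: c_def)
  have "0 < row_lcd_prod n P" using row(1) by (auto simp: row_lcd_prod_def intro!: prod_pos)
  \<comment> \<open>The same normalisation bound is applied twice, once with the product of the row
    denominators and once with the power of the overall denominator.\<close>
  from lcd_normalised_le[OF this D c_le cof(1)] lcd_normalised_le[OF _ M c_le cof(1)] all(1)
  show ?thesis unfolding set_pi by simp
qed

end
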